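(* Let $\mathcal{L}$ be a $4$-dimensional solvable Leibniz algebra over $\mathbb{C}$ whose nilradical is isomorphic to the $3$-dimensional algebra $\lambda_2:\ [e_1,e_1]=e_3$ (basis $\{e_1,e_2,e_3\}$). Then $\mathcal{L}$ is isomorphic to one of the following pairwise non-isomorphic algebras, each with basis $\{x,e_1,e_2,e_3\}$: $$\mathcal{L}_9(\gamma):\ [e_1,e_1]=e_3,\ [e_1,x]=e_1,\ [e_2,x]=\gamma e_2,\ [e_3,x]=2e_3,\ [x,e_1]=-e_1,\ [x,e_2]=-\gamma e_2;$$ $$\mathcal{L}_{10}(\delta):\ [e_1,e_1]=e_3,\ [e_1,x]=e_1,\ [e_2,x]=\delta e_2,\ [e_3,x]=2e_3,\ [x,e_1]=-e_1;$$ $$\mathcal{L}_{11}:\ [e_1,e_1]=e_3,\ [e_1,x]=e_1,\ [e_3,x]=2e_3,\ [x,e_1]=-e_1,\ [x,x]=e_2;$$ $$\mathcal{L}_{12}:\ [e_1,e_1]=e_3,\ [e_1,x]=e_1,\ [e_2,x]=2e_2+e_3,\ [e_3,x]=2e_3,\ [x,e_1]=-e_1;$$ $$\mathcal{L}_{13}:\ [e_1,e_1]=e_3,\ [e_1,x]=e_1+e_2,\ [e_2,x]=e_2,\ [e_3,x]=2e_3,\ [x,e_1]=-e_1-e_2,\ [x,e_2]=-e_2;$$ $$\mathcal{L}_{14}:\ [e_1,e_1]=e_3,\ [e_2,x]=e_2,\ [x,e_2]=-e_2;$$ $$\mathcal{L}_{15}(\lambda):\ [e_1,e_1]=e_3,\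 [e_2,x]=e_2,\ [x,e_1]=e_3,\ [x,e_2]=-e_2,\ [x,x]=\lambda e_3;$$ $$\mathcal{L}_{16}:\ [e_1,e_1]=e_3,\ [e_2,x]=e_2,\ [x,e_2]=-e_2,\ [x,x]=-2e_3;$$ $$\mathcal{L}_{17}:\ [e_1,e_1]=e_3,\ [e_2,x]=e_2;$$ $$\mathcal{L}_{18}(\mu):\ [e_1,e_1]=e_3,\ [e_2,x]=e_2,\ [x,e_1]=e_3,\ [x,x]=\mu e_3;$$ $$\mathcal{L}_{19}:\ [e_1,e_1]=e_3,\ [e_2,x]=e_2,\ [x,e_1]=e_3,\ [e_1,x]=e_3,$$ where $\gamma,\lambda,\mu\in\mathbb{C}$ and $\delta\in\mathbb{C}\setminus\{0\}$.
   Context: A (right) Leibniz algebra over $\mathbb{C}$ is a $\mathbb{C}$-vector space $\mathcal{L}$ with a bilinear bracket $[-,-]:\mathcal{L}\times\mathcal{L}\to\mathcal{L}$ satisfying $[x,[y,z]]=[[x,y],z]-[[x,z],y]$ for all $x,y,z\in\mathcal{L}$. All algebras are finite-dimensional over $\mathbb{C}$. Define $\mathcal{L}^1=\mathcal{L}$, $\mathcal{L}^{k+1}=[\mathcal{L}^k,\mathcal{L}]$ and $\mathcal{L}^{[1]}=\mathcal{L}$, $\mathcal{L}^{[s+1]}=[\mathcal{L}^{[s]},\mathcal{L}^{[s]}]$; $\mathcal{L}$ is nilpotent (resp. solvable) if $\mathcal{L}^n=0$ for some $n$ (resp. $\mathcal{L}^{[m]}=0$ for some $m$). The nilradical of $\mathcal{L}$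 is its maximal nilpotent (two-sided) ideal. In multiplication tables, products of basis elements that are not listed are zero. *)

theory Defs
  imports "HOL-Analysis.Analysis"
begin

locale leibniz_algebra = vector_space scale
  for scale :: "complex \<Rightarrow> 'a::ab_group_add \<Rightarrow> 'a" +
  fixes bracket :: "'a \<Rightarrow> 'a \<Rightarrow> 'a"
  assumes linear_left: "Vector_Spaces.linear scale scale (\<lambda>x. bracket x y)"
    and linear_right: "Vector_Spaces.linear scale scale (\<lambda>y. bracket x y)"
    and leibniz: "bracket x (bracket y z) = bracket (bracket x y) z - bracket (bracket x z) y"
begin

definition subspace_bracket :: "'a set \<Rightarrow> 'a set \<Rightarrow> 'a set" where
  "subspace_bracket A B = span {bracket a b | a b. a \<in> A \<and> b \<in> B}"

(* Both series start at index 0, so index k here is k + 1 in the usual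
   numbering, where the first term is the algebra itself. *)
primrec lower_central :: "'a set \<Rightarrow> nat \<Rightarrow> 'a set" where
  "lower_central A 0 = A"
| "lower_central A (Suc k) = subspace_bracket (lower_central A k) A"

primrec derived_series :: "'a set \<Rightarrow> nat \<Rightarrow> 'a set" where
  "derived_series A 0 = A"
| "derived_series A (Suc k) = subspace_bracket (derived_series A k) (derived_series A k)"

definition nilpotent :: "'a set \<Rightarrow> bool" where
  "nilpotent A \<longleftrightarrow> (\<exists>n. lower_central A n = {0})"

definition solvable :: "'a set \<Rightarrow> bool" where
  "solvable A \<longleftrightarrow> (\<exists>n. derived_series A n = {0})"

definition ideal :: "'a set \<Rightarrow> bool" where
  "ideal I \<longleftrightarrow> subspace I \<and> (\<forall>a\<in>I. \<forall>x. bracket a x \<in> I \<and> bracket x a \<in> I)"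

definition is_nilradical :: "'a set \<Rightarrow> bool" where
  "is_nilradical N \<longleftrightarrow> ideal N \<and> nilpotent N \<and>
     (\<forall>I. ideal I \<and> nilpotent I \<and> N \<subseteq> I \<longrightarrow> I = N)"

end

(* The carriers A and B are meant to be subspaces closed under the respective
   bracket; explicit carriers allow the nilradical to be compared with an
   algebra on a different type. *)
definition isomorphic_algebras ::
  "(complex \<Rightarrow> 'a::ab_group_add \<Rightarrow> 'a) \<Rightarrow> 'a set \<Rightarrow> ('a \<Rightarrow> 'a \<Rightarrow> 'a) \<Rightarrow>
   (complex \<Rightarrow> 'b::ab_group_add \<Rightarrow> 'b) \<Rightarrow> 'b set \<Rightarrow> ('b \<Rightarrow> 'b \<Rightarrow> 'b) \<Rightarrow> bool" where
  "isomorphic_algebras s\<^sub>1 A b\<^sub>1 s\<^sub>2 B b\<^sub>2 \<longleftrightarrow>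
     (\<exists>f. bij_betw f A B \<and>
        (\<forall>u\<in>A. \<forall>v\<in>A. f (u + v) = f u + f v) \<and>
        (\<forall>c. \<forall>u\<in>A. f (s\<^sub>1 c u) = s\<^sub>2 c (f u)) \<and>
        (\<forall>u\<in>A. \<forall>v\<in>A. f (b\<^sub>1 u v) = b\<^sub>2 (f u) (f v)))"

(* Bilinear extension of a multiplication table listing the products of pairs
   of basis vectors; unlisted products are zero. *)
definition table_bracket ::
  "(('n::finite \<times> 'n) \<times> (complex^'n)) list \<Rightarrow> complex^'n \<Rightarrow> complex^'n \<Rightarrow> complex^'n" where
  "table_bracket T u v = (\<Sum>i\<in>UNIV. \<Sum>j\<in>UNIV.
     (u $ i * v $ j) *s (case map_of T (i, j) of None \<Rightarrow> 0 | Some w \<Rightarrow> w))"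

definition lambda2 :: "complex^3 \<Rightarrow> complex^3 \<Rightarrow> complex^3" where
  "lambda2 = table_bracket [((1, 1), axis 3 1)]"

datatype gen = X | E1 | E2 | E3

lemma UNIV_gen: "UNIV = {X, E1, E2, E3}"
  using gen.exhaust by auto

instance gen :: finite
  by standard (simp add: UNIV_gen)

abbreviation e1 :: "complex^gen" where "e1 \<equiv> axis E1 1"
abbreviation e2 :: "complex^gen" where "e2 \<equiv> axis E2 1"
abbreviation e3 :: "complex^gen" where "e3 \<equiv> axis E3 1"

datatype label =
  L9 complex | L10 complex | L11 | L12 | L13 | L14 | L15 complex | L16 | L17 | L18 complex | L19

fun admissible :: "label \<Rightarrow> bool" where
  "admissible (L10 \<delta>) \<longleftrightarrow> \<delta> \<noteq> 0"
| "admissible _ \<longleftrightarrow> True"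

fun mult_table :: "label \<Rightarrow> ((gen \<times> gen) \<times> (complex^gen)) list" where
  "mult_table (L9 \<gamma>) =
    [((E1, E1), e3), ((E1, X), e1), ((E2, X), \<gamma> *s e2), ((E3, X), 2 *s e3),
     ((X, E1), - e1), ((X, E2), - \<gamma> *s e2)]"
| "mult_table (L10 \<delta>) =
    [((E1, E1), e3), ((E1, X), e1), ((E2, X), \<delta> *s e2), ((E3, X), 2 *s e3),
     ((X, E1), - e1)]"
| "mult_table L11 =
    [((E1, E1), e3), ((E1, X), e1), ((E3, X), 2 *s e3), ((X, E1), - e1), ((X, X), e2)]"
| "mult_table L12 =
    [((E1, E1), e3), ((E1, X), e1), ((E2, X), 2 *s e2 + e3), ((E3, X), 2 *s e3),
     ((X, E1), - e1)]"
| "mult_table L13 =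
    [((E1, E1), e3), ((E1, X), e1 + e2), ((E2, X), e2), ((E3, X), 2 *s e3),
     ((X, E1), - e1 - e2), ((X, E2), - e2)]"
| "mult_table L14 =
    [((E1, E1), e3), ((E2, X), e2), ((X, E2), - e2)]"
| "mult_table (L15 \<nu>) =
    [((E1, E1), e3), ((E2, X), e2), ((X, E1), e3), ((X, E2), - e2), ((X, X), \<nu> *s e3)]"
| "mult_table L16 =
    [((E1, E1), e3), ((E2, X), e2), ((X, E2), - e2), ((X, X), - 2 *s e3)]"
| "mult_table L17 =
    [((E1, E1), e3), ((E2, X), e2)]"
| "mult_table (L18 \<mu>) =
    [((E1, E1), e3), ((E2, X), e2), ((X, E1), e3), ((X, X), \<mu> *s e3)]"
| "mult_table L19 =
    [((E1, E1), e3), ((E2, X), e2), ((X, E1), e3), ((E1, X), e3)]"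

definition listed_bracket :: "label \<Rightarrow> complex^gen \<Rightarrow> complex^gen \<Rightarrow> complex^gen" where
  "listed_bracket l = table_bracket (mult_table l)"

lemma table_bracket_linear:
  "Vector_Spaces.linear (*s) (*s) (\<lambda>x. table_bracket T x y)"
  "Vector_Spaces.linear (*s) (*s) (\<lambda>y. table_bracket T x y)"
  unfolding table_bracket_def
  by (unfold_locales;
      simp add: vec_eq_iff sum.distrib[symmetric] sum_distrib_left algebra_simps)+

lemma sum_gen: "sum f (UNIV :: gen set) = f X + f E1 + f E2 + f E3"
  for f :: "gen \<Rightarrow> 'a::comm_monoid_add"
  by (simp add: UNIV_gen add.assoc)

lemma all_gen: "(\<forall>i. P i) \<longleftrightarrow> P X \<and> P E1 \<and> P E2 \<and> P E3"
  by (metis gen.exhaust)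

lemma leibniz_algebra_listed: "leibniz_algebra (*s) (listed_bracket l)"
proof -
  have "listed_bracket l x (listed_bracket l y z) =
      listed_bracket l (listed_bracket l x y) z - listed_bracket l (listed_bracket l x z) y" for x y z
    by (cases l; simp add: listed_bracket_def table_bracket_def sum_gen vec_eq_iff all_gen axis_def
        algebra_simps)
  then show ?thesis
    unfolding leibniz_algebra_def leibniz_algebra_axioms_def listed_bracket_def
    by (simp add: table_bracket_linear vec.vector_space_axioms)
qed

end

theory Submission
  imports Defs
begin

text \<open>
Let \<open>N\<close> be the nilradical, with basis \<open>e1, e2, e3\<close>, and choose any \<open>x\<close> outside \<open>N\<close>, so that
\<open>x, e1, e2, e3\<close> is a basis. Since \<open>[u, [v, v]] = 0\<close> always holds, \<open>e3 = [e1, e1]\<close> is annihilated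
from the left and \<open>[x, x]\<close> lies in \<open>N\<close>. Since right multiplication by \<open>x\<close> is a derivation of \<open>N\<close>,
it is triangular with eigenvalues \<open>a, b, 2 * a\<close> on \<open>e1, e2, e3\<close>. In this way the algebra is
described by eleven structure constants subject to a few quadratic equations
(\<open>extension_bracketI\<close>). If \<open>a = b = 0\<close> the whole algebra would be nilpotent, which contradicts
the maximality of \<open>N\<close> (\<open>not_nilpotent_right_multiplication\<close>).

An isomorphism between two algebras of this form must preserve the span of \<open>e1, e2, e3\<close>, because
right multiplications by its elements are nilpotent and those by other elements are not. It must then
be triangular, because \<open>e3 = [e1, e1]\<close> and \<open>[e2, e2] = 0\<close>. Hence isomorphism is the same as solvability
of an explicit system of polynomial equations, the predicate \<open>base_change\<close>; see
\<open>isomorphic_if_base_change\<close> and \<open>base_change_if_isomorphic\<close>. Both halves of the theorem are read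
off from this system.

For the classification, rescale \<open>x\<close> so that \<open>a = 1\<close>, or \<open>a = 0\<close> and \<open>b = 1\<close>. If \<open>a = 1\<close>
(\<open>classification_r11\<close>), the basis can be adapted to the eigenvectors of right multiplication by \<open>x\<close>,
except for the resonances \<open>b = 1\<close> and \<open>b = 2\<close>, which may give \<open>L13\<close> and \<open>L12\<close>, and \<open>b = 0\<close>, where \<open>[x, x]\<close>
may survive and then gives \<open>L11\<close>. If \<open>a = 0\<close> (\<open>classification_r22\<close>), one can split off \<open>e2\<close>, and what remains
are the \<open>e3\<close>-coefficients \<open>A, C, D\<close> of \<open>[e1, x], [x, e1], [x, x]\<close>. Replacing \<open>x\<close> by \<open>x + s e1\<close> and
\<open>e1\<close> by \<open>\<beta> e1\<close> leaves exactly \<open>C - A\<close> and \<open>D - A * C\<close>, up to division by \<open>\<beta>\<close> and \<open>\<beta>\<^sup>2\<close>.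

For non-isomorphism (\<open>base_change_label_unique\<close>), the normalisation forces the scaling of \<open>x\<close> to be
trivial; then \<open>a\<close>, \<open>b\<close> and the coefficient of \<open>e2\<close> in \<open>[x, e2]\<close> are invariants, and the remaining
coincidences are separated by the other equations, in particular by \<open>C - A\<close> and \<open>D - A * C\<close>.
\<close>

section \<open>Isomorphisms and bilinear maps\<close>

lemma isomorphic_algebras_sym:
  assumes "isomorphic_algebras s UNIV b s' UNIV b'"
  shows "isomorphic_algebras s' UNIV b' s UNIV b"
proof -
  obtain f where f: "bij f" "\<And>u v. f (u + v) = f u + f v"
    "\<And>c u. f (s c u) = s' c (f u)" "\<And>u v. f (b u v) = b' (f u) (f v)"
    using assms unfolding isomorphic_algebras_def by blast
  have "inv f (f u) = u" "f (inv f w) = w" for u w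
    using f(1) by (simp_all add: bij_is_inj bij_is_surj surj_f_inv_f)
  then have "inv f (u + v) = inv f u + inv f v" "inv f (s' c u) = s c (inv f u)"
    "inv f (b' u v) = b (inv f u) (inv f v)" for u v c
    using f(2-4) by metis+
  then show ?thesis
    unfolding isomorphic_algebras_def using bij_imp_bij_inv[OF f(1)] by blast
qed

lemma isomorphic_algebras_trans:
  assumes "isomorphic_algebras s UNIV b s' UNIV b'"
    and "isomorphic_algebras s' UNIV b' s'' UNIV b''"
  shows "isomorphic_algebras s UNIV b s'' UNIV b''"
proof -
  obtain f where f: "bij f" "\<And>u v. f (u + v) = f u + f v"
    "\<And>c u. f (s c u) = s' c (f u)" "\<And>u v. f (b u v) = b' (f u) (f v)"
    using assms(1) unfolding isomorphic_algebras_def by blast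
  obtain g where g: "bij g" "\<And>u v. g (u + v) = g u + g v"
    "\<And>c u. g (s' c u) = s'' c (g u)" "\<And>u v. g (b' u v) = b'' (g u) (g v)"
    using assms(2) unfolding isomorphic_algebras_def by blast
  show ?thesis
    unfolding isomorphic_algebras_def
    by (rule exI[of _ "g \<circ> f"]) (simp add: f g bij_comp)
qed

abbreviation x :: "complex^gen" where "x \<equiv> axis X 1"

lemma linear_on_axes:
  assumes "Vector_Spaces.linear (*s) sc h"
  shows "h v = (\<Sum>i\<in>UNIV. sc (v $ i) (h (axis i (1::complex))))"
proof -
  interpret h: Vector_Spaces.linear "(*s)" sc h by fact
  have "h (\<Sum>i\<in>UNIV. v $ i *s axis i 1) = (\<Sum>i\<in>UNIV. sc (v $ i) (h (axis i 1)))"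
    by (simp add: h.sum h.scale)
  then show ?thesis by (simp add: basis_expansion)
qed

text \<open>This reduces identities between brackets to identities between products of basis vectors.\<close>

lemma bilinear_eq_on_axes:
  fixes h k :: "complex^'n::finite \<Rightarrow> complex^'n \<Rightarrow> 'b::ab_group_add"
  assumes "\<And>v. Vector_Spaces.linear (*s) sc (\<lambda>u. h u v)"
    and "\<And>u. Vector_Spaces.linear (*s) sc (\<lambda>v. h u v)"
    and "\<And>v. Vector_Spaces.linear (*s) sc (\<lambda>u. k u v)"
    and "\<And>u. Vector_Spaces.linear (*s) sc (\<lambda>v. k u v)"
    and eq: "\<And>i j. h (axis i 1) (axis j 1) = k (axis i 1) (axis j 1)"
  shows "h u v = k u v"
proof -
  have "h (axis i 1) v = k (axis i 1) v" for i
    using linear_on_axes[where h = "h (axis i 1)" and v = v, OF assms(2)]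
      linear_on_axes[where h = "k (axis i 1)" and v = v, OF assms(4)]
    by (simp add: eq)
  then show ?thesis
    using linear_on_axes[where h = "\<lambda>u. h u v" and v = u, OF assms(1)]
      linear_on_axes[where h = "\<lambda>u. k u v" and v = u, OF assms(3)]
    by simp
qed

lemma axis_nth_eq: "axis i c $ j = (if j = i then c else 0)"
  by (simp add: axis_def)

lemma table_bracket_axes:
  "table_bracket T (axis i 1) (axis j 1) = (case map_of T (i, j) of None \<Rightarrow> 0 | Some w \<Rightarrow> w)"
proof -
  have "table_bracket T (axis i 1) (axis j 1) = (\<Sum>i'\<in>UNIV. \<Sum>j'\<in>UNIV.
     if i' = i then (if j' = j then (case map_of T (i', j') of None \<Rightarrow> 0 | Some w \<Rightarrow> w) else 0) else 0)"
    unfolding table_bracket_def by (intro sum.cong) (auto simp: axis_def)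
  also have "\<dots> = (\<Sum>i'\<in>UNIV. if i' = i then (case map_of T (i', j) of None \<Rightarrow> 0 | Some w \<Rightarrow> w) else 0)"
    by (intro sum.cong refl) simp
  finally show ?thesis by simp
qed

section \<open>One-dimensional extensions\<close>

text \<open>
Structure constants of an extension of the nilradical by one element \<open>x\<close>. The field \<open>rij\<close> is the
coefficient of \<open>ej\<close> in \<open>[ei, x]\<close>, the field \<open>lij\<close> that of \<open>ej\<close> in \<open>[x, ei]\<close>, and \<open>qj\<close> that of \<open>ej\<close>
in \<open>[x, x]\<close>. The coefficients without a field are determined by the Leibniz identity; in particular
\<open>[e3, x] = 2 * r11 e3\<close> because right multiplication by \<open>x\<close> is a derivation, and the
\<open>e1\<close>-coefficient of \<open>[x, e1]\<close> is \<open>- r11\<close>.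
\<close>

record coeffs =
  r11 :: complex r12 :: complex r13 :: complex
  r22 :: complex r23 :: complex
  l12 :: complex l13 :: complex
  l22 :: complex l23 :: complex
  q2 :: complex q3 :: complex

definition extension_bracket :: "coeffs \<Rightarrow> complex^gen \<Rightarrow> complex^gen \<Rightarrow> complex^gen" where
  "extension_bracket p = table_bracket
    [((E1, E1), e3),
     ((E1, X), r11 p *s e1 + r12 p *s e2 + r13 p *s e3),
     ((E2, X), r22 p *s e2 + r23 p *s e3),
     ((E3, X), (2 * r11 p) *s e3),
     ((X, E1), - r11 p *s e1 + l12 p *s e2 + l13 p *s e3),
     ((X, E2), l22 p *s e2 + l23 p *s e3),
     ((X, X), q2 p *s e2 + q3 p *s e3)]"

lemma extension_bracket_linear:
  "Vector_Spaces.linear (*s) (*s) (\<lambda>u. extension_bracket p u v)"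
  "Vector_Spaces.linear (*s) (*s) (\<lambda>v. extension_bracket p u v)"
  unfolding extension_bracket_def by (rule table_bracket_linear)+

lemma extension_bracket_simps:
  "extension_bracket p (u + v) w = extension_bracket p u w + extension_bracket p v w"
  "extension_bracket p w (u + v) = extension_bracket p w u + extension_bracket p w v"
  "extension_bracket p (c *s u) w = c *s extension_bracket p u w"
  "extension_bracket p w (c *s u) = c *s extension_bracket p w u"
  using extension_bracket_linear[where p = p]
  unfolding Vector_Spaces.linear_iff by blast+

lemma extension_bracket_nth:
  "extension_bracket p u v $ X = 0"
  "extension_bracket p u v $ E1 = r11 p * (u $ E1 * v $ X - u $ X * v $ E1)"
  "extension_bracket p u v $ E2 = r12 p * (u $ E1 * v $ X) + r22 p * (u $ E2 * v $ X)
     + l12 p * (u $ X * v $ E1) + l22 p * (u $ X * v $ E2) + q2 p * (u $ X * v $ X)"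
  "extension_bracket p u v $ E3 = u $ E1 * v $ E1 + r13 p * (u $ E1 * v $ X)
     + r23 p * (u $ E2 * v $ X) + 2 * r11 p * (u $ E3 * v $ X)
     + l13 p * (u $ X * v $ E1) + l23 p * (u $ X * v $ E2) + q3 p * (u $ X * v $ X)"
  by (simp_all add: extension_bracket_def table_bracket_def sum_gen axis_nth_eq algebra_simps)

text \<open>The relations between structure constants that the classification uses, all of them consequences of the
Leibniz identity. The first six say that \<open>[x, e2]\<close> vanishes unless \<open>[e1, x] + [x, e1]\<close>,
\<open>[e2, x] + [x, e2]\<close> and \<open>[x, x]\<close>, which are annihilated by \<open>x\<close> from the left, have no \<open>e2\<close>-component.\<close>

definition leibniz_equations :: "coeffs \<Rightarrow> bool" where
  "leibniz_equations p \<longleftrightarrow>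
     (r12 p + l12 p) * l22 p = 0 \<and> (r12 p + l12 p) * l23 p = 0 \<and>
     (r22 p + l22 p) * l22 p = 0 \<and> (r22 p + l22 p) * l23 p = 0 \<and>
     q2 p * l22 p = 0 \<and> q2 p * l23 p = 0 \<and>
     r11 p * l12 p + r12 p * l22 p = l12 p * r22 p - r11 p * r12 p \<and>
     r12 p * l23 p + r11 p * r13 p = l12 p * r23 p + r11 p * l13 p \<and>
     r22 p * l23 p = l22 p * r23 p + 2 * r11 p * l23 p"

lemma leibniz_equations_extension:
  assumes "leibniz_algebra (*s) (extension_bracket p)"
  shows "leibniz_equations p"
proof -
  interpret leibniz_algebra "(*s)" "extension_bracket p" by fact
  let ?J = "\<lambda>u v w i. extension_bracket p u (extension_bracket p v w) $ i =
     (extension_bracket p (extension_bracket p u v) w - extension_bracket p (extension_bracket p u w) v) $ i"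
  have J: "?J u v w i" for u v w i
    using leibniz[of u v w] by metis
  have "q2 p * l22 p = 0" "q2 p * l23 p = 0"
    using J[of x x x E2] J[of x x x E3] by (auto simp: extension_bracket_nth axis_nth_eq)
  then show ?thesis
    using J[of x e1 x E2] J[of x e1 x E3] J[of x x e1 E2] J[of x x e1 E3]
      J[of x e2 x E2] J[of x e2 x E3] J[of x x e2 E2] J[of x x e2 E3]
    unfolding leibniz_equations_def
    by (simp add: extension_bracket_nth axis_nth_eq del: mult_eq_0_iff) (intro conjI; algebra)
qed

text \<open>Every vector \<open>[v, w] + [w, v]\<close> is annihilated from the left by all elements. Left multiplication by
\<open>e1\<close> reads off the \<open>e1\<close>-coefficient of a vector of the nilradical, so symmetrised products have
\<open>e1\<close>-coefficient zero. This fixes the \<open>e1\<close>-coefficients of all products with \<open>x\<close> once that of \<open>[e1, x]\<close>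
is known; the derivation property of right multiplication by \<open>x\<close>, applied to \<open>[e1, e2] = 0\<close> and
\<open>[e1, e1] = e3\<close>, settles \<open>[e2, x]\<close> and \<open>[e3, x]\<close>.\<close>

lemma extension_bracketI:
  fixes B :: "complex^gen \<Rightarrow> complex^gen \<Rightarrow> complex^gen"
  assumes leib: "leibniz_algebra (*s) B"
    and ideal: "\<And>u v. u $ X = 0 \<Longrightarrow> B u v $ X = 0 \<and> B v u $ X = 0"
    and nil: "\<And>i j. i \<noteq> X \<Longrightarrow> j \<noteq> X \<Longrightarrow>
       B (axis i 1) (axis j 1) = (if i = E1 \<and> j = E1 then e3 else 0)"
  obtains p where "B = extension_bracket p" "leibniz_equations p"
proof -
  interpret leibniz_algebra "(*s)" B by fact
  have right: "B u v = v $ X *s B u x + v $ E1 *s B u e1 + v $ E2 *s B u e2 + v $ E3 *s B u e3" for u v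
    using linear_on_axes[OF linear_right, of u v] by (simp add: sum_gen)
  have left: "B u v = u $ X *s B x v + u $ E1 *s B e1 v + u $ E2 *s B e2 v + u $ E3 *s B e3 v" for u v
    using linear_on_axes[OF linear_left, of u v] by (simp add: sum_gen)
  have square: "B u (B v v) = 0" for u v
    using leibniz[of u v v] by simp
  have N: "B (axis i 1) v $ X = 0" "B v (axis i 1) $ X = 0" if "i \<noteq> X" for i v
    using ideal[of "axis i 1"] that by (simp_all add: axis_nth_eq)
  have e3x: "B u e3 = 0" for u
    using square[of u e1] nil[of E1 E1] by simp
  have sym: "B u (B v w) + B u (B w v) = 0" for u v w
    using leibniz[of u v w] leibniz[of u w v] by simp
  \<comment> \<open>The quotient by the ideal is one-dimensional and spanned by the class of \<open>x\<close>, so \<open>[x, [x, x]] = 0\<close>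
    forces its square to vanish there.\<close>
  have xx: "B x x $ X = 0" "B x x $ E1 = 0"
  proof -
    have "B x (B x x) $ X = B x x $ X * B x x $ X"
      by (subst right) (simp add: N)
    then show X: "B x x $ X = 0" by (simp add: square)
    have "B e1 (B x x) $ E3 = B x x $ E1"
      by (subst right) (simp add: X nil axis_nth_eq)
    then show "B x x $ E1 = 0" by (simp add: square)
  qed
  have xe1: "B x e1 $ E1 = - (B e1 x $ E1)"
  proof -
    have "(B e1 (B x e1) + B e1 (B e1 x)) $ E3 = B x e1 $ E1 + B e1 x $ E1"
      by (subst (1 3) right) (simp add: N nil axis_nth_eq)
    then show ?thesis by (simp add: sym add_eq_0_iff)
  qed
  have e2x: "B e2 x $ E1 = 0"
  proof -
    have "B e1 (B e2 x) $ E3 = B e2 x $ E1"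
      by (subst right) (simp add: N nil axis_nth_eq)
    moreover have "B e1 (B e2 x) = - B (B e1 x) e2"
      using leibniz[of e1 e2 x] left[of 0 x] nil[of E1 E2] by simp
    moreover have "B (B e1 x) e2 = 0"
      by (subst left) (simp add: N nil)
    ultimately show ?thesis by simp
  qed
  have xe2: "B x e2 $ E1 = 0"
  proof -
    have "(B e1 (B x e2) + B e1 (B e2 x)) $ E3 = B x e2 $ E1 + B e2 x $ E1"
      by (subst (1 3) right) (simp add: N nil axis_nth_eq)
    then show ?thesis by (simp add: sym e2x)
  qed
  have e3x': "B e3 x = (2 * B e1 x $ E1) *s e3"
  proof -
    have "B e1 (B e1 x) = B (B e1 e1) x - B (B e1 x) e1"
      by (rule leibniz)
    moreover have "B e1 (B e1 x) = B e1 x $ E1 *s e3"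
      by (subst right) (simp add: N nil)
    moreover have "B (B e1 x) e1 = B e1 x $ E1 *s e3"
      by (subst left) (simp add: N nil)
    moreover have "B e1 e1 = e3" by (simp add: nil)
    ultimately show ?thesis by (simp add: vec_eq_iff algebra_simps)
  qed
  define p where "p = \<lparr>r11 = B e1 x $ E1, r12 = B e1 x $ E2, r13 = B e1 x $ E3,
    r22 = B e2 x $ E2, r23 = B e2 x $ E3, l12 = B x e1 $ E2, l13 = B x e1 $ E3,
    l22 = B x e2 $ E2, l23 = B x e2 $ E3, q2 = B x x $ E2, q3 = B x x $ E3\<rparr>"
  have "B (axis i 1) (axis j 1) = extension_bracket p (axis i 1) (axis j 1)" for i j
    unfolding extension_bracket_def table_bracket_axes
    by (cases i; cases j;
      simp add: p_def nil e3x e3x'; simp add: vec_eq_iff all_gen N xx xe1 e2x xe2 axis_nth_eq)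
  then have "B u v = extension_bracket p u v" for u v
    by (rule bilinear_eq_on_axes[where h = B and k = "extension_bracket p", OF
      linear_left linear_right extension_bracket_linear])
  then have "B = extension_bracket p" by blast
  then show thesis
    using that leibniz_equations_extension leib by blast
qed

section \<open>Coordinates on an algebra with the given nilradical\<close>

context leibniz_algebra
begin

lemma bracket_simps:
  "bracket (u + v) w = bracket u w + bracket v w" "bracket w (u + v) = bracket w u + bracket w v"
  "bracket (scale c u) w = scale c (bracket u w)" "bracket w (scale c u) = scale c (bracket w u)"
  "bracket 0 w = 0" "bracket w 0 = 0"
proof -
  interpret l: Vector_Spaces.linear scale scale "\<lambda>u. bracket u w" by (rule linear_left)
  interpret r: Vector_Spaces.linear scale scale "\<lambda>u. bracket w u" by (rule linear_right)
  show "bracket (u + v) w = bracket u w + bracket v w" "bracket w (u + v) = bracket w u + bracket w v"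
    "bracket (scale c u) w = scale c (bracket u w)" "bracket w (scale c u) = scale c (bracket w u)"
    "bracket 0 w = 0" "bracket w 0 = 0"
    by (rule l.add r.add l.scale r.scale l.zero r.zero)+
qed

text \<open>The sets of elements all of whose iterated right products of a given length vanish are subspaces, and
each term of the lower central series lies in the corresponding one.\<close>

lemma nilpotent_UNIV_I:
  assumes "\<And>u v w y z. bracket (bracket (bracket (bracket u v) w) y) z = 0"
  shows "nilpotent UNIV"
proof -
  let ?A = "\<lambda>S. {a. \<forall>z. bracket a z \<in> S}"
  have sub: "subspace (?A S)" if "subspace S" for S
    using that by (auto simp: subspace_def bracket_simps)
  have step: "subspace_bracket B UNIV \<subseteq> S" if "subspace S" "B \<subseteq> ?A S" for B S
    unfolding subspace_bracket_def using that by (intro span_minimal) auto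
  have 0: "subspace {0}" by (rule subspace_single_0)
  have "lower_central UNIV (Suc (Suc (Suc (Suc 0)))) \<subseteq> {0}"
    unfolding lower_central.simps
    by (intro step sub 0) (auto simp: assms)
  moreover have "0 \<in> lower_central UNIV (Suc (Suc (Suc (Suc 0))))"
    by (simp add: subspace_bracket_def span_zero)
  ultimately show ?thesis
    unfolding nilpotent_def by blast
qed

text \<open>When both eigenvalues vanish, each right multiplication lowers the filtration of the algebra by the spans
of \<open>e1, e2, e3\<close>, then \<open>e2, e3\<close>, then \<open>e3\<close>, then \<open>0\<close>. The whole algebra is then a nilpotent ideal larger
than its nilradical.\<close>

lemma not_nilpotent_right_multiplication:
  assumes "is_nilradical N" "N \<noteq> UNIV"
    and "isomorphic_algebras scale UNIV bracket (*s) UNIV (extension_bracket p)"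
  shows "r11 p \<noteq> 0 \<or> r22 p \<noteq> 0"
proof (rule ccontr)
  assume "\<not> ?thesis"
  then have "extension_bracket p (extension_bracket p (extension_bracket p (extension_bracket p u v) w) y) z = 0"
    for u v w y z
    by (simp add: vec_eq_iff all_gen extension_bracket_nth)
  moreover obtain f where f: "bij f" "\<And>c u. f (scale c u) = c *s f u"
    "\<And>u v. f (bracket u v) = extension_bracket p (f u) (f v)"
    using assms(3) unfolding isomorphic_algebras_def by blast
  moreover have "f u = 0 \<Longrightarrow> u = 0" for u
    using f(2)[of 0 0] bij_is_inj[OF f(1)] by (simp add: inj_eq[symmetric])
  ultimately have "nilpotent UNIV"
    by (intro nilpotent_UNIV_I) simp
  moreover have "ideal UNIV" by (simp add: ideal_def)
  ultimately show False
    using assms(1,2) unfolding is_nilradical_def by blast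
qed

text \<open>The type carries no finite-dimensionality assumption; it follows because a space without a finite basis
would have dimension \<open>0\<close>. A vector outside the range would extend the image of the standard basis to
an independent set with more elements than a basis.\<close>

lemma injective_coordinates_surj:
  fixes \<phi> :: "complex^'n \<Rightarrow> 'a"
  assumes "Vector_Spaces.linear (*s) scale \<phi>" "inj \<phi>" and dim: "dim UNIV = CARD('n)"
  shows "surj \<phi>"
proof -
  interpret \<phi>: Vector_Spaces.linear "(*s)" scale \<phi> by fact
  let ?S = "\<phi> ` cart_basis"
  have ind: "independent ?S"
    using independent_cart_basis assms(2)
    by (intro \<phi>.independent_injective_image) (auto intro: inj_on_subset)
  have card: "finite ?S" "card ?S = CARD('n)"
    using assms(2) by (simp_all add: finite_cart_basis card_cart_basis card_image inj_on_subset)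
  have range: "span ?S = range \<phi>"
    by (simp add: \<phi>.span_image span_cart_basis)
  obtain T where T: "span T = UNIV" "card T = CARD('n)"
    using basis_exists[of UNIV] dim by (metis top.extremum_unique)
  then have T_fin: "finite T" by (simp add: card_ge_0_finite)
  have "u \<in> range \<phi>" for u
  proof (rule ccontr)
    assume u: "u \<notin> range \<phi>"
    then have "independent (insert u ?S)"
      using ind range by (simp add: independent_insert)
    then have "card (insert u ?S) \<le> card T"
      using independent_span_bound[OF T_fin] T(1) by blast
    moreover have "u \<notin> ?S" using u by blast
    ultimately show False using card T(2) by simp
  qed
  then show ?thesis by blast
qed

text \<open>The basis consists of the preimages of the standard basis under the given isomorphism, and of a vector
\<open>y\<close> outside \<open>N\<close>. In these coordinates \<open>N\<close> is the hyperplane where the \<open>X\<close>-component vanishes, and the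
bracket is pulled back along the coordinate map \<open>\<phi>\<close>.\<close>

lemma coordinates:
  assumes dim: "dim (UNIV :: 'a set) = 4" and "ideal N"
    and "isomorphic_algebras scale N bracket (*s) UNIV lambda2"
  obtains p where "isomorphic_algebras scale UNIV bracket (*s) UNIV (extension_bracket p)"
    "leibniz_equations p" "N \<noteq> UNIV"
proof -
  obtain f where f: "bij_betw f N UNIV"
    "\<And>u v. u \<in> N \<Longrightarrow> v \<in> N \<Longrightarrow> f (u + v) = f u + f v"
    "\<And>c u. u \<in> N \<Longrightarrow> f (scale c u) = c *s f u"
    "\<And>u v. u \<in> N \<Longrightarrow> v \<in> N \<Longrightarrow> f (bracket u v) = lambda2 (f u) (f v)"
    using assms(3) unfolding isomorphic_algebras_def by blast
  have N: "subspace N" "\<And>u v. u \<in> N \<Longrightarrow> bracket u v \<in> N \<and> bracket v u \<in> N"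
    using assms(2) unfolding ideal_def by auto
  have f_inj: "u = v" if "f u = f v" "u \<in> N" "v \<in> N" for u v
    using that f(1) by (auto simp: bij_betw_def inj_on_def)
  define g where "g i = inv_into N f (axis i 1)" for i
  have g: "g i \<in> N" "f (g i) = axis i 1" for i
    using f(1) by (auto simp: g_def bij_betw_def inv_into_into f_inv_into_f)
  have f0: "f 0 = 0"
    using f(3)[OF g(1), of 0] by simp
  have comb: "scale a (g 1) + scale b (g 2) + scale c (g 3) \<in> N"
    "f (scale a (g 1) + scale b (g 2) + scale c (g 3)) = a *s axis 1 1 + b *s axis 2 1 + c *s axis 3 1"
    for a b c
    using N(1) by (simp_all add: f subspace_add subspace_scale g)
  have prods: "bracket (g i) (g j) = (if i = 1 \<and> j = 1 then g 3 else 0)" for i j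
    using N g subspace_0[OF N(1)]
    by (intro f_inj) (auto simp: f f0 lambda2_def table_bracket_axes)
  have "N \<noteq> UNIV"
  proof
    assume "N = UNIV"
    have "u = scale (f u $ 1) (g 1) + scale (f u $ 2) (g 2) + scale (f u $ 3) (g 3)" for u
      using comb by (intro f_inj) (auto simp: \<open>N = UNIV\<close> vec_eq_iff forall_3 axis_nth_eq)
    then have "u \<in> span {g 1, g 2, g 3}" for u
      by (metis insertCI span_add span_base span_scale)
    then have "dim UNIV \<le> card {g 1, g 2, g 3}"
      by (intro dim_le_card) auto
    also have "\<dots> \<le> 3"
      by (simp add: card_insert_if)
    finally show False using dim by simp
  qed
  then obtain y where y: "y \<notin> N" by blast
  define \<phi> where "\<phi> v = scale (v $ X) y +
    (scale (v $ E1) (g 1) + scale (v $ E2) (g 2) + scale (v $ E3) (g 3))" for v :: "complex^gen"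
  interpret \<phi>: Vector_Spaces.linear "(*s)" scale \<phi>
    by unfold_locales (simp_all add: \<phi>_def algebra_simps scale_left_distrib scale_right_distrib)
  have \<phi>_axes: "\<phi> e1 = g 1" "\<phi> e2 = g 2" "\<phi> e3 = g 3"
    by (simp_all add: \<phi>_def axis_nth_eq)
  have \<phi>_N: "\<phi> v \<in> N \<longleftrightarrow> v $ X = 0" for v
  proof
    assume "\<phi> v \<in> N"
    then have "\<phi> v - (scale (v $ E1) (g 1) + scale (v $ E2) (g 2) + scale (v $ E3) (g 3)) \<in> N"
      using comb(1) N(1) by (blast intro: subspace_diff)
    then have "scale (v $ X) y \<in> N" by (simp add: \<phi>_def)
    then have "v $ X \<noteq> 0 \<Longrightarrow> scale (inverse (v $ X)) (scale (v $ X) y) \<in> N"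
      using N(1) by (blast intro: subspace_scale)
    then show "v $ X = 0" using y by auto
  qed (simp add: \<phi>_def comb(1))
  have "v = 0" if "\<phi> v = 0" for v
  proof -
    have "v $ X = 0"
      using \<phi>_N[of v] that subspace_0[OF N(1)] by simp
    then show ?thesis
      using comb(2)[of "v $ E1" "v $ E2" "v $ E3"] that f0
      by (simp add: \<phi>_def vec_eq_iff forall_3 all_gen axis_nth_eq)
  qed
  then have inj: "inj \<phi>" by (simp add: \<phi>.inj_iff_eq_0)
  have surj: "surj \<phi>"
    by (rule injective_coordinates_surj[OF \<phi>.linear_axioms inj]) (simp add: dim UNIV_gen)
  define B where "B u v = inv \<phi> (bracket (\<phi> u) (\<phi> v))" for u v
  have \<phi>B: "\<phi> (B u v) = bracket (\<phi> u) (\<phi> v)" for u v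
    by (simp add: B_def surj_f_inv_f[OF surj])
  have eqI: "u = v" if "\<phi> u = \<phi> v" for u v
    using inj that by (rule injD)
  have lin: "Vector_Spaces.linear (*s) (*s) (\<lambda>u. B u v)" "Vector_Spaces.linear (*s) (*s) (\<lambda>u. B v u)" for v
    by (unfold_locales; intro eqI; simp add: \<phi>B \<phi>.add \<phi>.scale bracket_simps)+
  have "leibniz_algebra (*s) B"
    unfolding leibniz_algebra_def leibniz_algebra_axioms_def
    by (auto intro!: lin vec.vector_space_axioms eqI simp: \<phi>B \<phi>.diff leibniz)
  moreover have "B u v $ X = 0 \<and> B v u $ X = 0" if "u $ X = 0" for u v
    using that N(2) by (simp add: \<phi>_N[symmetric] \<phi>B)
  moreover have "B (axis i 1) (axis j 1) = (if i = E1 \<and> j = E1 then e3 else 0)"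
    if "i \<noteq> X" "j \<noteq> X" for i j
    using that by (intro eqI; cases i; cases j) (simp_all add: \<phi>B \<phi>_axes \<phi>.zero prods)
  ultimately obtain p where p: "B = extension_bracket p" "leibniz_equations p"
    by (rule extension_bracketI)
  have "isomorphic_algebras (*s) UNIV (extension_bracket p) scale UNIV bracket"
    unfolding isomorphic_algebras_def
    by (rule exI[of _ \<phi>]) (simp add: bij_def inj surj \<phi>.add \<phi>.scale \<phi>B flip: p(1))
  then show thesis
    using that p(2) \<open>N \<noteq> UNIV\<close> isomorphic_algebras_sym by blast
qed

end

section \<open>Changes of basis\<close>

text \<open>The linear maps that can be isomorphisms: the images of \<open>e1\<close> and \<open>e2\<close> have leading coefficients \<open>\<beta>\<close> and
\<open>\<rho>\<close>, and the coefficient \<open>\<beta>\<^sup>2\<close> is forced by \<open>e3 = [e1, e1]\<close>.\<close>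

definition triangular_map ::
  "complex \<Rightarrow> complex \<Rightarrow> complex \<Rightarrow> complex \<Rightarrow> complex \<Rightarrow> complex \<Rightarrow> complex \<Rightarrow> complex \<Rightarrow> complex
    \<Rightarrow> complex^gen \<Rightarrow> complex^gen" where
  "triangular_map \<kappa> \<beta> \<rho> s1 s2 s3 t2 t3 t v = (\<chi> i. case i of
     X \<Rightarrow> \<kappa> * v $ X
   | E1 \<Rightarrow> s1 * v $ X + \<beta> * v $ E1
   | E2 \<Rightarrow> s2 * v $ X + t2 * v $ E1 + \<rho> * v $ E2
   | E3 \<Rightarrow> s3 * v $ X + t3 * v $ E1 + t * v $ E2 + \<beta>\<^sup>2 * v $ E3)"

text \<open>The conditions under which the triangular map is an isomorphism from the algebra with structure
constants \<open>p\<close> to the one with structure constants \<open>p'\<close>: equality of the components of the two sides of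
the homomorphism equation on the pairs \<open>(e1, x), (e2, x), (x, e1), (x, e2), (x, x)\<close>, with nonzero common
factors cancelled.\<close>

definition base_change ::
  "coeffs \<Rightarrow> coeffs \<Rightarrow> complex \<Rightarrow> complex \<Rightarrow> complex \<Rightarrow> complex \<Rightarrow> complex \<Rightarrow> complex
    \<Rightarrow> complex \<Rightarrow> complex \<Rightarrow> complex \<Rightarrow> bool" where
  "base_change p p' \<kappa> \<beta> \<rho> s1 s2 s3 t2 t3 t \<longleftrightarrow>
     \<kappa> \<noteq> 0 \<and> \<beta> \<noteq> 0 \<and> \<rho> \<noteq> 0 \<and>
     r11 p = \<kappa> * r11 p' \<and> r22 p = \<kappa> * r22 p' \<and> l22 p = \<kappa> * l22 p' \<and>
     r11 p * t2 + r12 p * \<rho> = \<kappa> * (r12 p' * \<beta> + r22 p' * t2) \<and>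
     r11 p * t3 + r12 p * t + r13 p * \<beta>\<^sup>2
       = \<beta> * s1 + \<kappa> * (r13 p' * \<beta> + r23 p' * t2 + 2 * r11 p' * t3) \<and>
     r22 p * t + r23 p * \<beta>\<^sup>2 = \<kappa> * (r23 p' * \<rho> + 2 * r11 p' * t) \<and>
     l12 p * \<rho> - r11 p * t2 = \<kappa> * (l12 p' * \<beta> + l22 p' * t2) \<and>
     l12 p * t + l13 p * \<beta>\<^sup>2 - r11 p * t3
       = s1 * \<beta> + \<kappa> * (l13 p' * \<beta> + l23 p' * t2) \<and>
     l22 p * t + l23 p * \<beta>\<^sup>2 = \<kappa> * (l23 p' * \<rho>) \<and>
     q2 p * \<rho> = \<kappa> * ((r12 p' + l12 p') * s1 + (r22 p' + l22 p') * s2) + \<kappa>\<^sup>2 * q2 p' \<and>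
     q2 p * t + q3 p * \<beta>\<^sup>2 = s1\<^sup>2 + \<kappa> * ((r13 p' + l13 p') * s1 + (r23 p' + l23 p') * s2
       + 2 * r11 p' * s3) + \<kappa>\<^sup>2 * q3 p'"

lemma triangular_map_nth:
  "triangular_map \<kappa> \<beta> \<rho> s1 s2 s3 t2 t3 t v $ X = \<kappa> * v $ X"
  "triangular_map \<kappa> \<beta> \<rho> s1 s2 s3 t2 t3 t v $ E1 = s1 * v $ X + \<beta> * v $ E1"
  "triangular_map \<kappa> \<beta> \<rho> s1 s2 s3 t2 t3 t v $ E2 = s2 * v $ X + t2 * v $ E1 + \<rho> * v $ E2"
  "triangular_map \<kappa> \<beta> \<rho> s1 s2 s3 t2 t3 t v $ E3
     = s3 * v $ X + t3 * v $ E1 + t * v $ E2 + \<beta>\<^sup>2 * v $ E3"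
  by (simp_all add: triangular_map_def)

lemma linear_triangular_map:
  "Vector_Spaces.linear (*s) (*s) (triangular_map \<kappa> \<beta> \<rho> s1 s2 s3 t2 t3 t)"
  by unfold_locales (simp_all add: vec_eq_iff all_gen triangular_map_nth algebra_simps)

lemma bij_triangular_map:
  assumes "\<kappa> \<noteq> 0" "\<beta> \<noteq> 0" "\<rho> \<noteq> 0"
  shows "bij (triangular_map \<kappa> \<beta> \<rho> s1 s2 s3 t2 t3 t)"
proof -
  interpret T: Vector_Spaces.linear "(*s)" "(*s)" "triangular_map \<kappa> \<beta> \<rho> s1 s2 s3 t2 t3 t"
    by (rule linear_triangular_map)
  have "inj (triangular_map \<kappa> \<beta> \<rho> s1 s2 s3 t2 t3 t)"
    unfolding T.inj_iff_eq_0
    using assms by (auto simp: vec_eq_iff all_gen triangular_map_nth)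
  then show ?thesis
    using vec.linear_inj_imp_surj[OF T.linear_axioms] by (simp add: bij_def)
qed

lemma triangular_map_hom_iff:
  fixes \<kappa> \<beta> \<rho> s1 s2 s3 t2 t3 t :: complex
  assumes "\<kappa> \<noteq> 0" "\<beta> \<noteq> 0" "\<rho> \<noteq> 0"
  defines "T \<equiv> triangular_map \<kappa> \<beta> \<rho> s1 s2 s3 t2 t3 t"
  shows "(\<forall>u v. T (extension_bracket p u v) = extension_bracket p' (T u) (T v))
    \<longleftrightarrow> base_change p p' \<kappa> \<beta> \<rho> s1 s2 s3 t2 t3 t" (is "?hom \<longleftrightarrow> _")
proof -
  interpret T: Vector_Spaces.linear "(*s)" "(*s)" T
    unfolding T_def by (rule linear_triangular_map)
  let ?h = "\<lambda>u v. T (extension_bracket p u v)" and ?k = "\<lambda>u v. extension_bracket p' (T u) (T v)"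
  have lin: "Vector_Spaces.linear (*s) (*s) (\<lambda>u. ?h u v)" "Vector_Spaces.linear (*s) (*s) (\<lambda>u. ?h v u)"
    "Vector_Spaces.linear (*s) (*s) (\<lambda>u. ?k u v)" "Vector_Spaces.linear (*s) (*s) (\<lambda>u. ?k v u)" for v
    unfolding Vector_Spaces.linear_iff
    by (simp_all add: vec.vector_space_axioms extension_bracket_simps T.add T.scale)
  have "?hom \<longleftrightarrow> (\<forall>i j. ?h (axis i 1) (axis j 1) = ?k (axis i 1) (axis j 1))"
    using bilinear_eq_on_axes[where h = ?h and k = ?k, OF lin] by blast
  also have "\<dots> \<longleftrightarrow> base_change p p' \<kappa> \<beta> \<rho> s1 s2 s3 t2 t3 t"
    using assms(1-3)
    by (simp add: all_gen T_def vec_eq_iff extension_bracket_nth triangular_map_nth axis_nth_eq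
        base_change_def, simp add: algebra_simps power2_eq_square, blast)
  finally show ?thesis .
qed

lemma isomorphic_if_base_change:
  assumes "base_change p p' \<kappa> \<beta> \<rho> s1 s2 s3 t2 t3 t"
  shows "isomorphic_algebras (*s) UNIV (extension_bracket p) (*s) UNIV (extension_bracket p')"
proof -
  let ?T = "triangular_map \<kappa> \<beta> \<rho> s1 s2 s3 t2 t3 t"
  interpret T: Vector_Spaces.linear "(*s)" "(*s)" ?T
    by (rule linear_triangular_map)
  have nz: "\<kappa> \<noteq> 0" "\<beta> \<noteq> 0" "\<rho> \<noteq> 0"
    using assms unfolding base_change_def by auto
  show ?thesis
    unfolding isomorphic_algebras_def
    using bij_triangular_map[OF nz] triangular_map_hom_iff[OF nz, THEN iffD2, OF assms]
    by (intro exI[of _ ?T]) (simp add: T.add T.scale)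
qed

text \<open>If the \<open>X\<close>-component of \<open>v\<close> vanishes, the third power of right multiplication by \<open>v\<close> is zero, and so is
that by \<open>f v\<close>. The \<open>e1\<close>- and \<open>e2\<close>-components of this power on \<open>e1\<close> and \<open>e2\<close> are \<open>(r11 p' * c) ^ 3\<close> and
\<open>(r22 p' * c) ^ 3\<close>, where \<open>c\<close> is the \<open>X\<close>-component of \<open>f v\<close>, so \<open>c = 0\<close> because one of the constants is nonzero.
Now \<open>[f e1, f e1] = f e3\<close> and \<open>[f e2, f e2] = 0\<close> determine the triangular shape.\<close>

lemma base_change_if_isomorphic:
  assumes iso: "isomorphic_algebras (*s) UNIV (extension_bracket p) (*s) UNIV (extension_bracket p')"
    and p': "r11 p' \<noteq> 0 \<or> r22 p' \<noteq> 0"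
  obtains \<kappa> \<beta> \<rho> s1 s2 s3 t2 t3 t where "base_change p p' \<kappa> \<beta> \<rho> s1 s2 s3 t2 t3 t"
proof -
  let ?B = "extension_bracket p" and ?B' = "extension_bracket p'"
  obtain f where f: "bij f" "\<And>u v. f (u + v) = f u + f v" "\<And>c u. f (c *s u) = c *s f u"
    "\<And>u v. f (?B u v) = ?B' (f u) (f v)"
    using iso unfolding isomorphic_algebras_def by blast
  have lin: "Vector_Spaces.linear (*s) (*s) f"
    by unfold_locales (simp_all add: f algebra_simps)
  have f0: "f 0 = 0" using f(3)[of 0 0] by simp
  have inj: "u = v" if "f u = f v" for u v
    using f(1) that by (auto simp: bij_def inj_def)
  have surj: "\<exists>u. f u = w" for w
    using f(1) by (metis bij_pointE)
  have nil: "f v $ X = 0" if "v $ X = 0" for v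
  proof -
    have "?B (?B (?B u v) v) v = 0" for u
      using that by (simp add: vec_eq_iff all_gen extension_bracket_nth)
    then have "?B' (?B' (?B' w (f v)) (f v)) (f v) = 0" for w
      using surj[of w] f(4) f0 by metis
    from this[of e1] this[of e2] show ?thesis
      using p' by (auto simp: vec_eq_iff all_gen extension_bracket_nth axis_nth_eq)
  qed
  define \<kappa> \<beta> \<rho> t where "\<kappa> = f x $ X" and "\<beta> = f e1 $ E1" and "\<rho> = f e2 $ E2" and "t = f e2 $ E3"
  have fX: "f e1 $ X = 0" "f e2 $ X = 0"
    by (simp_all add: nil axis_nth_eq)
  have fe3: "f e3 = \<beta>\<^sup>2 *s e3"
  proof -
    have "?B e1 e1 = e3"
      by (simp add: vec_eq_iff all_gen extension_bracket_nth axis_nth_eq)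
    then have "f e3 = ?B' (f e1) (f e1)" by (metis f(4))
    then show ?thesis
      by (simp add: vec_eq_iff all_gen extension_bracket_nth axis_nth_eq fX \<beta>_def power2_eq_square)
  qed
  have fe2: "f e2 = \<rho> *s e2 + t *s e3"
  proof -
    have "?B e2 e2 = 0"
      by (simp add: vec_eq_iff all_gen extension_bracket_nth axis_nth_eq)
    then have "?B' (f e2) (f e2) = 0" by (metis f(4) f0)
    then have "f e2 $ E1 = 0"
      by (simp add: vec_eq_iff all_gen extension_bracket_nth fX)
    then show ?thesis
      by (simp add: vec_eq_iff all_gen axis_nth_eq fX \<rho>_def t_def)
  qed
  have "f v = triangular_map \<kappa> \<beta> \<rho> (f x $ E1) (f x $ E2) (f x $ E3) (f e1 $ E2) (f e1 $ E3) t v" for v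
  proof -
    have "f v = v $ X *s f x + v $ E1 *s f e1 + v $ E2 *s f e2 + v $ E3 *s f e3"
      using linear_on_axes[OF lin, of v] unfolding sum_gen .
    then show ?thesis
      unfolding vec_eq_iff all_gen triangular_map_nth
      by (simp add: fe2 fe3 fX axis_nth_eq flip: \<kappa>_def \<beta>_def)
  qed
  then obtain s1 s2 s3 t2 t3 where eq: "\<And>v. f v = triangular_map \<kappa> \<beta> \<rho> s1 s2 s3 t2 t3 t v"
    by (rule that)
  have \<beta>: "\<beta> \<noteq> 0"
  proof
    assume "\<beta> = 0"
    then have "e3 = 0" using fe3 f0 inj[of e3 0] by simp
    then show False by (simp add: axis_eq_0_iff)
  qed
  have \<rho>: "\<rho> \<noteq> 0"
  proof
    assume "\<rho> = 0"
    then have "e2 = (t / \<beta>\<^sup>2) *s e3"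
      using fe2 fe3 \<beta> inj[of e2 "(t / \<beta>\<^sup>2) *s e3"] by (simp add: f(3))
    then show False by (simp add: vec_eq_iff all_gen axis_nth_eq)
  qed
  have \<kappa>: "\<kappa> \<noteq> 0"
    using surj[of x] by (auto simp: eq vec_eq_iff all_gen triangular_map_nth axis_nth_eq)
  show thesis
    using that triangular_map_hom_iff[OF \<kappa> \<beta> \<rho>] f(4) unfolding eq by blast
qed

section \<open>The listed algebras\<close>

definition zero_coeffs :: coeffs where
  "zero_coeffs = \<lparr>r11 = 0, r12 = 0, r13 = 0, r22 = 0, r23 = 0,
    l12 = 0, l13 = 0, l22 = 0, l23 = 0, q2 = 0, q3 = 0\<rparr>"

fun label_coeffs :: "label \<Rightarrow> coeffs" where
  "label_coeffs (L9 \<gamma>) = zero_coeffs\<lparr>r11 := 1, r22 := \<gamma>, l22 := - \<gamma>\<rparr>"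
| "label_coeffs (L10 \<delta>) = zero_coeffs\<lparr>r11 := 1, r22 := \<delta>\<rparr>"
| "label_coeffs L11 = zero_coeffs\<lparr>r11 := 1, q2 := 1\<rparr>"
| "label_coeffs L12 = zero_coeffs\<lparr>r11 := 1, r22 := 2, r23 := 1\<rparr>"
| "label_coeffs L13 = zero_coeffs\<lparr>r11 := 1, r12 := 1, r22 := 1, l12 := - 1, l22 := - 1\<rparr>"
| "label_coeffs L14 = zero_coeffs\<lparr>r22 := 1, l22 := - 1\<rparr>"
| "label_coeffs (L15 \<nu>) = zero_coeffs\<lparr>r22 := 1, l22 := - 1, l13 := 1, q3 := \<nu>\<rparr>"
| "label_coeffs L16 = zero_coeffs\<lparr>r22 := 1, l22 := - 1, q3 := - 2\<rparr>"
| "label_coeffs L17 = zero_coeffs\<lparr>r22 := 1\<rparr>"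
| "label_coeffs (L18 \<mu>) = zero_coeffs\<lparr>r22 := 1, l13 := 1, q3 := \<mu>\<rparr>"
| "label_coeffs L19 = zero_coeffs\<lparr>r22 := 1, l13 := 1, r13 := 1\<rparr>"

lemma listed_bracket_eq: "listed_bracket l = extension_bracket (label_coeffs l)"
proof (intro ext)
  show "listed_bracket l u v = extension_bracket (label_coeffs l) u v" for u v
    unfolding vec_eq_iff all_gen extension_bracket_nth
    by (cases l) (simp_all add: zero_coeffs_def listed_bracket_def table_bracket_def sum_gen axis_nth_eq)
qed

text \<open>Each label is normalised so that \<open>r11 = 1\<close>, or \<open>r11 = 0\<close> and \<open>r22 = 1\<close>; since \<open>r11\<close> and \<open>r22\<close> both scale by
\<open>\<kappa>\<close>, this gives \<open>\<kappa> = 1\<close>. The triple \<open>(r11, r22, l22)\<close> is then invariant, which leaves only the pairs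
\<open>L9 0\<close> and \<open>L11\<close>, \<open>L10 2\<close> and \<open>L12\<close>, \<open>L9 1\<close> and \<open>L13\<close>, and the two families \<open>L14\<close> to \<open>L16\<close> and \<open>L17\<close> to \<open>L19\<close>.
The pairs differ in whether \<open>q2\<close>, \<open>r23\<close> or \<open>r12\<close> vanishes. Within the families, \<open>l13 - r13\<close> and
\<open>q3 - r13 * l13\<close> are invariant up to \<open>\<beta>\<close> and \<open>\<beta>\<^sup>2\<close>; in the parametrised ones the first equals \<open>1\<close>, so that
\<open>\<beta> = 1\<close> and the second is the parameter.\<close>

lemma base_change_label_unique:
  assumes bc: "base_change (label_coeffs l) (label_coeffs l') \<kappa> \<beta> \<rho> s1 s2 s3 t2 t3 t"
    and adm: "admissible l" "admissible l'"
  shows "l = l'"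
proof -
  have norm: "r11 (label_coeffs l) = 1 \<or> r11 (label_coeffs l) = 0 \<and> r22 (label_coeffs l) = 1" for l
    by (cases l) (simp_all add: zero_coeffs_def)
  have \<kappa>: "\<kappa> = 1"
    using norm[of l] norm[of l'] bc unfolding base_change_def by auto
  have normal: "r12 (label_coeffs l) = 0 \<and> r23 (label_coeffs l) = 0 \<and> l12 (label_coeffs l) = 0
      \<and> l23 (label_coeffs l) = 0 \<and> q2 (label_coeffs l) = 0" if "r11 (label_coeffs l) = 0" for l
    using that by (cases l) (simp_all add: zero_coeffs_def)
  let ?p = "label_coeffs l" and ?p' = "label_coeffs l'"
  have "(l13 ?p - r13 ?p) * \<beta> = l13 ?p' - r13 ?p' \<and>
      (q3 ?p - r13 ?p * l13 ?p) * \<beta>\<^sup>2 = q3 ?p' - r13 ?p' * l13 ?p'" if r11: "r11 ?p = 0"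
  proof -
    have eqs: "r13 ?p * \<beta>\<^sup>2 = \<beta> * s1 + r13 ?p' * \<beta>" "l13 ?p * \<beta>\<^sup>2 = s1 * \<beta> + l13 ?p' * \<beta>"
      and q3: "q3 ?p * \<beta>\<^sup>2 = s1\<^sup>2 + (r13 ?p' + l13 ?p') * s1 + q3 ?p'" and "\<beta> \<noteq> 0"
      using bc r11 normal[of l] normal[of l'] unfolding base_change_def \<kappa> by auto
    have "\<beta> * (r13 ?p * \<beta>) = \<beta> * (s1 + r13 ?p')" "\<beta> * (l13 ?p * \<beta>) = \<beta> * (s1 + l13 ?p')"
      using eqs by (simp_all add: algebra_simps power2_eq_square)
    then have s1: "r13 ?p * \<beta> = s1 + r13 ?p'" "l13 ?p * \<beta> = s1 + l13 ?p'"
      using \<open>\<beta> \<noteq> 0\<close> by auto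
    have "(q3 ?p - r13 ?p * l13 ?p) * \<beta>\<^sup>2 = q3 ?p * \<beta>\<^sup>2 - (r13 ?p * \<beta>) * (l13 ?p * \<beta>)"
      by (simp add: algebra_simps power2_eq_square)
    also have "\<dots> = q3 ?p' - r13 ?p' * l13 ?p'"
      unfolding s1 q3 by (simp add: algebra_simps power2_eq_square)
    finally show ?thesis
      using s1 by (simp add: algebra_simps)
  qed
  then show ?thesis
    using bc adm unfolding base_change_def \<kappa>
    by (cases l; cases l') (auto simp: zero_coeffs_def)
qed

section \<open>Reduction to the list\<close>

lemma rescale_outer_element:
  assumes "r11 p \<noteq> 0 \<or> r22 p \<noteq> 0" "leibniz_equations p"
  obtains p' where "isomorphic_algebras (*s) UNIV (extension_bracket p') (*s) UNIV (extension_bracket p)"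
    "leibniz_equations p'" "r11 p' = 1 \<or> r11 p' = 0 \<and> r22 p' = 1"
proof -
  define \<kappa> where "\<kappa> = (if r11 p = 0 then inverse (r22 p) else inverse (r11 p))"
  have \<kappa>: "\<kappa> \<noteq> 0" using assms(1) by (auto simp: \<kappa>_def)
  define p' where "p' = \<lparr>r11 = \<kappa> * r11 p, r12 = \<kappa> * r12 p, r13 = \<kappa> * r13 p, r22 = \<kappa> * r22 p,
    r23 = \<kappa> * r23 p, l12 = \<kappa> * l12 p, l13 = \<kappa> * l13 p, l22 = \<kappa> * l22 p, l23 = \<kappa> * l23 p,
    q2 = \<kappa>\<^sup>2 * q2 p, q3 = \<kappa>\<^sup>2 * q3 p\<rparr>"
  have "base_change p' p \<kappa> 1 1 0 0 0 0 0 0"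
    using \<kappa> by (simp add: base_change_def p'_def)
  moreover have "leibniz_equations p'"
    using assms(2) unfolding leibniz_equations_def p'_def coeffs.simps
    by (elim conjE, intro conjI) algebra+
  moreover have "r11 p' = 1 \<or> r11 p' = 0 \<and> r22 p' = 1"
    using assms(1) by (simp add: p'_def \<kappa>_def)
  ultimately show thesis
    using that isomorphic_if_base_change by blast
qed

text \<open>It suffices to take \<open>s1 = 0\<close>: the image of \<open>x\<close> need not involve \<open>e1\<close>. The parameter \<open>t\<close> moves \<open>e2\<close> to an
eigenvector of right multiplication by \<open>x\<close>, which is impossible only for eigenvalue \<open>2\<close> with \<open>r23 \<noteq> 0\<close>;
\<open>t2\<close> does the same for \<open>e1\<close>, with the only obstruction at eigenvalue \<open>1\<close>; \<open>s2\<close> and \<open>s3\<close> remove \<open>[x, x]\<close>,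
except for its \<open>e2\<close>-component when the eigenvalue of \<open>e2\<close> is \<open>0\<close>. The main distinction is
whether \<open>[x, e2]\<close> vanishes.\<close>

lemma classification_r11:
  assumes eqs: "leibniz_equations p" and r11: "r11 p = 1"
  shows "\<exists>l \<beta> \<rho> s2 s3 t2 t3 t. admissible l \<and> base_change (label_coeffs l) p 1 \<beta> \<rho> 0 s2 s3 t2 t3 t"
proof (cases "l22 p = 0 \<and> l23 p = 0")
  case True
  have l12: "r12 p = l12 p * r22 p - l12 p" and r13: "r13 p = l12 p * r23 p + l13 p"
    using eqs True r11 by (simp_all add: leibniz_equations_def algebra_simps)
  show ?thesis
  proof (cases "r22 p = 0")
    case b0: True
    show ?thesis
    proof (cases "q2 p = 0")
      case True
      have "base_change (label_coeffs (L9 0)) p 1 1 1 0 0 (- q3 p / 2) (- l12 p) (- l13 p) (- r23 p / 2)"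
        using \<open>l22 p = 0 \<and> l23 p = 0\<close> b0 True l12 r13 r11
        by (simp add: base_change_def zero_coeffs_def)
      then show ?thesis by (metis admissible.simps(2))
    next
      case False
      have "base_change (label_coeffs L11) p 1 1 (q2 p) 0 0 ((- r23 p * q2 p / 2 - q3 p) / 2)
          (- l12 p) (- l13 p) (- r23 p * q2 p / 2)"
        using \<open>l22 p = 0 \<and> l23 p = 0\<close> b0 False l12 r13 r11
        by (simp add: base_change_def zero_coeffs_def diff_divide_distrib)
      then show ?thesis by (metis admissible.simps(3))
    qed
  next
    case b: False
    define s2 where "s2 = - q2 p / r22 p"
    have s2: "r22 p * s2 + q2 p = 0" using b by (simp add: s2_def)
    show ?thesis
    proof (cases "r22 p = 2 \<and> r23 p \<noteq> 0")
      case False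
      \<comment> \<open>When \<open>r22 p = 2\<close>, the numerator \<open>r23 p\<close> is zero here and the quotient below is \<open>0 / 0 = 0\<close>.\<close>
      have "base_change (label_coeffs (L10 (r22 p))) p 1 1 1 0 s2 (- (q3 p + r23 p * s2) / 2)
          (- l12 p) (- l13 p) (r23 p / (r22 p - 2))"
        using \<open>l22 p = 0 \<and> l23 p = 0\<close> b False l12 r13 r11 s2
        by (auto simp: base_change_def zero_coeffs_def field_simps)
      then show ?thesis using b by (metis admissible.simps(1))
    next
      case True
      have "base_change (label_coeffs L12) p 1 1 (1 / r23 p) 0 s2 (- (q3 p + r23 p * s2) / 2)
          (- l12 p) (- l13 p) 0"
        using \<open>l22 p = 0 \<and> l23 p = 0\<close> True l12 r13 r11 s2
        by (auto simp: base_change_def zero_coeffs_def field_simps)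
      then show ?thesis by (metis admissible.simps(4))
    qed
  qed
next
  case False
  have sums: "r12 p + l12 p = 0" "r22 p + l22 p = 0" and q2: "q2 p = 0"
    using eqs False by (auto simp: leibniz_equations_def)
  then have l12: "l12 p = - r12 p" and l22: "l22 p = - r22 p"
    by (simp_all add: eq_neg_iff_add_eq_0 add.commute)
  have "r22 p * l23 p = l22 p * r23 p + 2 * l23 p" "r12 p * l23 p + r13 p = l12 p * r23 p + l13 p"
    using eqs r11 by (simp_all add: leibniz_equations_def)
  then have l23: "r22 p * l23 p = - r22 p * r23 p + 2 * l23 p"
    and l13: "l13 p = r13 p + r12 p * (r23 p + l23 p)"
    by (simp_all add: l12 l22 algebra_simps)
  have b: "r22 p \<noteq> 0" using False l22 l23 by auto
  \<comment> \<open>Dividing by \<open>r22 p\<close> also covers the eigenvalue \<open>2\<close>, where \<open>r23 p\<close> vanishes but \<open>l23 p\<close> need not.\<close>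
  define t where "t = - l23 p / r22 p"
  have t: "r22 p * t = - l23 p" using b by (simp add: t_def)
  have t': "r22 p * t = r23 p + 2 * t"
  proof -
    have "r22 p * (r22 p * t) = r22 p * (r23 p + 2 * t)"
      using l23 t by algebra
    then show ?thesis using b by simp
  qed
  show ?thesis
  proof (cases "r22 p = 1 \<and> r12 p \<noteq> 0")
    case False
    define t2 where "t2 = r12 p / (1 - r22 p)"
    have t2: "r12 p = t2 - r22 p * t2"
      using False by (auto simp: t2_def field_simps)
    have "base_change (label_coeffs (L9 (r22 p))) p 1 1 1 0 0 (- q3 p / 2) t2 (- r13 p - r23 p * t2) t"
      unfolding base_change_def
      using l12 l22 q2 l13 l23 r11 t t'
      by (simp add: zero_coeffs_def t2) algebra
    then show ?thesis by (metis admissible.simps(2))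
  next
    case True
    have "base_change (label_coeffs L13) p 1 1 (r12 p) 0 0 (- q3 p / 2)
        0 (- r23 p * r12 p - r13 p) (- r23 p * r12 p)"
      unfolding base_change_def
      using l12 l22 q2 l13 l23 r11 True
      by (simp add: zero_coeffs_def algebra_simps)
    then show ?thesis by (metis admissible.simps(5))
  qed
qed

text \<open>The change of basis sends \<open>e2\<close> to \<open>e2 + r23 e3\<close>, an eigenvector of right multiplication by \<open>x\<close>, and \<open>t2\<close>
and \<open>s2\<close> remove the \<open>e2\<close>-components of \<open>[e1, x]\<close>, \<open>[x, e1]\<close> and \<open>[x, x]\<close>. The differences \<open>r13 - r12 * r23\<close> and
\<open>l13 - r12 * l23\<close> are the \<open>e3\<close>-coefficients of \<open>[e1, x]\<close> and \<open>[x, e1]\<close> after this step, and \<open>q3 - q2 * r23\<close>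
plays the same role for \<open>[x, x]\<close>. The three hypotheses on \<open>a, c, d\<close> record the effect of the remaining
freedom: a multiple \<open>s1 e1\<close> is added to \<open>x\<close>, and \<open>e1\<close> is scaled by \<open>\<beta>\<close>.\<close>

lemma base_change_r22:
  assumes eqs: "leibniz_equations p" and r: "r11 p = 0" "r22 p = 1"
    and q: "q = zero_coeffs\<lparr>r22 := 1, l22 := l22 p, r13 := a, l13 := c, q3 := d\<rparr>"
    and "\<beta> \<noteq> 0"
    and a: "a * \<beta> = s1 + (r13 p - r12 p * r23 p)"
    and c: "c * \<beta> = s1 + (l13 p - r12 p * l23 p)"
    and d: "d * \<beta>\<^sup>2 = (s1 + (r13 p - r12 p * r23 p)) * (s1 + (l13 p - r12 p * l23 p))
      + (q3 p - q2 p * r23 p - (r13 p - r12 p * r23 p) * (l13 p - r12 p * l23 p))"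
  shows "\<exists>s2. base_change q p 1 \<beta> 1 s1 s2 0 (- r12 p * \<beta>) 0 (r23 p)"
proof -
  have l: "l12 p = r12 p * l22 p" "l23 p = l22 p * r23 p" "l22 p = 0 \<or> l22 p = - 1"
    "l22 p = 0 \<or> q2 p = 0"
    using eqs r by (auto simp: leibniz_equations_def add_eq_0_iff)
  define s2 where "s2 = (if l22 p = 0 then - q2 p - r12 p * s1 else 0)"
  have a': "a * \<beta>\<^sup>2 = \<beta> * (s1 + (r13 p - r12 p * r23 p))"
    unfolding a[symmetric] by (simp add: power2_eq_square)
  have c': "c * \<beta>\<^sup>2 = \<beta> * (s1 + (l13 p - r12 p * l23 p))"
    unfolding c[symmetric] by (simp add: power2_eq_square)
  have "base_change q p 1 \<beta> 1 s1 s2 0 (- r12 p * \<beta>) 0 (r23 p)"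
    unfolding base_change_def
    using \<open>\<beta> \<noteq> 0\<close> r l a' c' d
    by (auto simp: q s2_def zero_coeffs_def algebra_simps power2_eq_square)
  then show ?thesis ..
qed

text \<open>With \<open>A, C, F\<close> as in the proof, if \<open>A \<noteq> C\<close> then \<open>\<beta> = C - A\<close> normalises the difference to \<open>1\<close> and \<open>F\<close> becomes a
parameter. If \<open>A = C\<close>, only the vanishing of \<open>F\<close> matters, since \<open>\<beta>\<close> can be chosen as a square root.\<close>

lemma classification_r22:
  assumes eqs: "leibniz_equations p" and r: "r11 p = 0" "r22 p = 1"
  shows "\<exists>l \<beta> s1 s2 t2 t. admissible l \<and> base_change (label_coeffs l) p 1 \<beta> 1 s1 s2 0 t2 0 t"
proof -
  define A where "A = r13 p - r12 p * r23 p"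
  define C where "C = l13 p - r12 p * l23 p"
  define F where "F = q3 p - q2 p * r23 p - A * C"
  have l22: "l22 p = 0 \<or> l22 p = - 1"
    using eqs r by (auto simp: leibniz_equations_def add_eq_0_iff)
  have witness: ?thesis
    if "label_coeffs l = zero_coeffs\<lparr>r22 := 1, l22 := l22 p, r13 := a, l13 := c, q3 := d\<rparr>"
      "admissible l" "\<beta> \<noteq> 0" "a * \<beta> = s1 + A" "c * \<beta> = s1 + C" "d * \<beta>\<^sup>2 = (s1 + A) * (s1 + C) + F"
    for l a c d \<beta> s1
    using base_change_r22[OF eqs r that(1,3), of s1] that(2,4-6)
    unfolding A_def C_def F_def by blast
  show ?thesis
  proof (cases "A = C")
    case False
    let ?d = "F / (C - A)\<^sup>2"
    show ?thesis
      using l22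
    proof
      assume "l22 p = 0"
      then show ?thesis
        using False[symmetric] by (intro witness[where l = "L18 ?d" and a = 0 and c = 1 and d = "?d"
            and \<beta> = "C - A" and ?s1.0 = "- A"]) (simp_all add: zero_coeffs_def)
    next
      assume "l22 p = - 1"
      then show ?thesis
        using False[symmetric] by (intro witness[where l = "L15 ?d" and a = 0 and c = 1 and d = "?d"
            and \<beta> = "C - A" and ?s1.0 = "- A"]) (simp_all add: zero_coeffs_def)
    qed
  next
    case True
    show ?thesis
    proof (cases "F = 0")
      case F0: True
      show ?thesis
        using l22
      proof
        assume "l22 p = 0"
        then show ?thesis
          using True F0 by (intro witness[where l = L17 and a = 0 and c = 0 and d = 0
            and \<beta> = 1 and ?s1.0 = "- A"]) (simp_all add: zero_coeffs_def)
      next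
        assume "l22 p = - 1"
        then show ?thesis
          using True F0 by (intro witness[where l = L14 and a = 0 and c = 0 and d = 0
            and \<beta> = 1 and ?s1.0 = "- A"]) (simp_all add: zero_coeffs_def)
      qed
    next
      case False
      show ?thesis
        using l22
      proof
        assume "l22 p = 0"
        \<comment> \<open>In \<open>L19\<close> the constants \<open>r13\<close> and \<open>l13\<close> are \<open>1\<close> and \<open>q3\<close> is \<open>0\<close>, so \<open>s1 + A = \<beta>\<close> and \<open>0 = \<beta>\<^sup>2 + F\<close>.\<close>
        moreover have "(csqrt (- F))\<^sup>2 = - F" by simp
        ultimately show ?thesis
          using True False
          by (intro witness[where l = L19 and a = 1 and c = 1 and d = 0
            and \<beta> = "csqrt (- F)" and ?s1.0 = "csqrt (- F) - A"])
            (simp_all add: zero_coeffs_def power2_eq_square)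
      next
        assume "l22 p = - 1"
        \<comment> \<open>In \<open>L16\<close> the constant \<open>q3\<close> is \<open>- 2\<close>, so \<open>- 2 * \<beta>\<^sup>2 = F\<close>.\<close>
        moreover have "(csqrt (- F / 2))\<^sup>2 = - F / 2" by simp
        ultimately show ?thesis
          using True False
          by (intro witness[where l = L16 and a = 0 and c = 0 and d = "-2"
            and \<beta> = "csqrt (- F / 2)" and ?s1.0 = "- A"])
            (simp_all add: zero_coeffs_def)
      qed
    qed
  qed
qed

theorem proposition3p10:
  shows "(\<forall>(scale :: complex \<Rightarrow> 'a::ab_group_add \<Rightarrow> 'a) bracket N.
            leibniz_algebra scale bracket \<and>
            vector_space.dim scale (UNIV :: 'a set) = 4 \<and>
            leibniz_algebra.solvable scale bracket UNIV \<and>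
            leibniz_algebra.is_nilradical scale bracket N \<and>
            isomorphic_algebras scale N bracket (*s) UNIV lambda2 \<longrightarrow>
            (\<exists>l. admissible l \<and>
               isomorphic_algebras scale UNIV bracket (*s) UNIV (listed_bracket l)))
       \<and> (\<forall>l l'. admissible l \<and> admissible l' \<and> l \<noteq> l' \<longrightarrow>
            \<not> isomorphic_algebras (*s) UNIV (listed_bracket l) (*s) UNIV (listed_bracket l'))"
proof (intro conjI allI impI; elim conjE)
  fix scale :: "complex \<Rightarrow> 'a \<Rightarrow> 'a" and bracket N
  assume "leibniz_algebra scale bracket" and dim: "vector_space.dim scale (UNIV :: 'a set) = 4"
    and nilradical: "leibniz_algebra.is_nilradical scale bracket N"
    and N: "isomorphic_algebras scale N bracket (*s) UNIV lambda2"
  interpret leibniz_algebra scale bracket by fact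
  have "ideal N" using nilradical by (simp add: is_nilradical_def)
  from coordinates[OF dim this N] obtain p
    where p: "isomorphic_algebras scale UNIV bracket (*s) UNIV (extension_bracket p)"
      "leibniz_equations p" and "N \<noteq> UNIV" by blast
  from not_nilpotent_right_multiplication[OF nilradical this(3,1)] p(2)
  obtain p' where p': "isomorphic_algebras (*s) UNIV (extension_bracket p') (*s) UNIV (extension_bracket p)"
    "leibniz_equations p'" "r11 p' = 1 \<or> r11 p' = 0 \<and> r22 p' = 1"
    by (rule rescale_outer_element)
  from p'(3) obtain l where l: "admissible l"
    "isomorphic_algebras (*s) UNIV (extension_bracket (label_coeffs l)) (*s) UNIV (extension_bracket p')"
    using classification_r11[OF p'(2)] classification_r22[OF p'(2)] isomorphic_if_base_change by blast
  then show "\<exists>l. admissible l \<and> isomorphic_algebras scale UNIV bracket (*s) UNIV (listed_bracket l)"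
    unfolding listed_bracket_eq
    using isomorphic_algebras_trans[OF p(1) isomorphic_algebras_sym[OF isomorphic_algebras_trans[OF l(2) p'(1)]]]
    by blast
next
  fix l l'
  assume adm: "admissible l" "admissible l'" and "l \<noteq> l'"
  have "r11 (label_coeffs l') \<noteq> 0 \<or> r22 (label_coeffs l') \<noteq> 0"
    by (cases l') (simp_all add: zero_coeffs_def)
  then show "\<not> isomorphic_algebras (*s) UNIV (listed_bracket l) (*s) UNIV (listed_bracket l')"
    unfolding listed_bracket_eq
    using base_change_if_isomorphic base_change_label_unique[OF _ adm] \<open>l \<noteq> l'\<close> by metis
qed

end
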